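(* Let $H=\langle m_0,\dots,m_p,n\rangle$ be a numerical semigroup minimally generated by an almost arithmetic sequence, with associated data as in the context, and assume $W\ne\emptyset$. Suppose $r'=1$, $\mu=0$, $q'>0$ and $r\ge2$. Then for every element $\alpha_i$ of $\mathrm{PF}_1(H)=\{\alpha_i: i\in[1,p-r+1]\}$, there exists an $\mathrm{RF}$-matrix for $\alpha_i$ whose rows (indexed by $0,1,\dots,p,n$) are: (1) row $0$: $-E_0+(q'-1)E_p+(v-1)E_n+E_i$; (2) row $j$ for $j\in[1,p-i]$: $-E_j+(q'-1)E_p+(v-1)E_n+E_{i+j}$; (3) row $j$ for $j\in[p-i+1,p]$: $(\nu-2)E_0-E_j+(w-1)E_n+E_{i+j-p-1}$; (4) row $n$: $(q-1)E_p-E_n+E_{r+i-1}$.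
   Context: Notation: $\mathbb N=\{0,1,2,\dots\}$; $[a,b]$ is the set of integers $i$ with $a\le i\le b$. Let $p\ge1$, $d\ge1$, $m_0\ge 1$ be integers, $m_i=m_0+id$ for $i\in[0,p]$, and $n\ge1$ an integer with $\gcd(m_0,d,n)=1$. Put $H'=\sum_{i=0}^p\mathbb Nm_i$ and $H=H'+\mathbb Nn=\langle m_0,\dots,m_p,n\rangle$; assume $\{m_0,\dots,m_p,n\}$ is a minimal generating set of $H$. $\mathrm{Ap}(H,m_0)=\{h\in H: h-m_0\notin H\}$. For $t\in\mathbb N$ write $t=q_tp+r_t$ with $q_t\in\mathbb Z$, $r_t\in[1,p]$, and set $g_t=q_tm_p+m_{r_t}$ (so $q_0=-1$, $r_0=p$, $g_0=0$). Let $u=\min\{t\in\mathbb N: g_t\notin\mathrm{Ap}(H,m_0)\}$ and $v=\min\{b\ge1: bn\in H'\}$. It is known (Patil–Singh) that there are unique integers $z\in[0,u-1]$, $w\in[0,v-1]$, $\lambda\ge1$, $\mu\ge0$ with $g_u=\lambda m_0+wn$, $vn=\mu m_0+g_z$, and $g_{u-z}+(v-w)n=\nu m_0$, where $\nu=\lambda+\mu+1$ if $r_{u-z}<r_u$ and $\nu=\lambda+\mu$ if $r_{u-z}\ge r_u$. Set $r=r_u$, $q=q_u$, $r'=r_{u-z}$, $q'=q_{u-z}$, and $W=[u-z,u-1]\times[v-w,v-1]$ (empty iff $z=0$ or $w=0$). $\mathrm{PF}(H)$ is the set of $f\in\mathbb Z\setminus H$ with $f+h\in H$ for all $h\in H\setminus\{0\}$.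 An $\mathrm{RF}$-matrix for $f\in\mathrm{PF}(H)$ is a $(p+2)\times(p+2)$ integer matrix with rows and columns indexed by $0,1,\dots,p,n$ (corresponding to the generators $m_0,\dots,m_p,n$), with all diagonal entries $-1$, all off-diagonal entries in $\mathbb N$, and such that each row $(b_0,\dots,b_p,b_n)$ satisfies $\sum_{j=0}^p b_jm_j+b_nn=f$. $E_0,\dots,E_p,E_n$ denote the standard basis vectors of $\mathbb Z^{p+2}$ (coordinates indexed by $0,\dots,p,n$). When $W\neq\emptyset$, let $\alpha_i=g_{(q'-1)p+i}+(v-1)n-m_0$ for $i\in I$, where $I=\{p\}$ if $r'=1,q'=0$; $I=[1,p]$ if $r'=1,q'>0$; $I=[p+1,p+r'-1]$ if $r'\ge2$. $\mathrm{PF}_1(H)$ denotes the set of pseudo-Frobenius numbers of $H$ of the form $\alpha_i$, $i\in I$. *)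

theory Defs
  imports "Jordan_Normal_Form.Matrix"
begin

text \<open>Only used for finite \<open>A\<close>.\<close>

definition semigroup_span :: "int set \<Rightarrow> int set" where
  "semigroup_span A = {\<Sum>a\<in>A. int (c a) * a | c :: int \<Rightarrow> nat. True}"

definition minimal_generating_set :: "int set \<Rightarrow> int set \<Rightarrow> bool" where
  "minimal_generating_set A H \<longleftrightarrow>
     semigroup_span A = H \<and> (\<forall>B. B \<subset> A \<longrightarrow> semigroup_span B \<noteq> H)"

definition Ap :: "int set \<Rightarrow> int \<Rightarrow> int set" where
  "Ap H a = {h \<in> H. h - a \<notin> H}"

definition PF :: "int set \<Rightarrow> int set" where
  "PF H = {f. f \<notin> H \<and> (\<forall>h \<in> H - {0}. f + h \<in> H)}"

definition marith :: "nat \<Rightarrow> nat \<Rightarrow> nat \<Rightarrow> int" where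
  "marith d m0 i = int m0 + int i * int d"

definition gens :: "nat \<Rightarrow> nat \<Rightarrow> nat \<Rightarrow> nat \<Rightarrow> int set" where
  "gens p d m0 n = insert (int n) (marith d m0 ` {0..p})"

definition Hsg' :: "nat \<Rightarrow> nat \<Rightarrow> nat \<Rightarrow> int set" where
  "Hsg' p d m0 = semigroup_span (marith d m0 ` {0..p})"

definition Hsg :: "nat \<Rightarrow> nat \<Rightarrow> nat \<Rightarrow> nat \<Rightarrow> int set" where
  "Hsg p d m0 n = semigroup_span (gens p d m0 n)"

text \<open>
  The decomposition \<open>t = q\<^sub>t p + r\<^sub>t\<close> with \<open>r\<^sub>t \<in> [1,p]\<close> (not \<open>[0,p-1]\<close>); in particular
  \<open>q\<^sub>0 = -1\<close>, \<open>r\<^sub>0 = p\<close>.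
\<close>

definition quo :: "nat \<Rightarrow> nat \<Rightarrow> int" where
  "quo p t = (int t - 1) div int p"

definition rem :: "nat \<Rightarrow> nat \<Rightarrow> nat" where
  "rem p t = nat ((int t - 1) mod int p) + 1"

lemma quo_rem_unique:
  assumes "p \<ge> 1"
  shows "int t = q * int p + int r \<and> r \<in> {1..p} \<longleftrightarrow> q = quo p t \<and> r = rem p t"
proof
  assume A: "int t = q * int p + int r \<and> r \<in> {1..p}"
  then have e: "int t - 1 = (int r - 1) + q * int p" by simp
  have b: "0 \<le> int r - 1" "int r - 1 < int p" using A by auto
  have "quo p t = q" unfolding quo_def e using b by simp
  moreover have "rem p t = r" unfolding rem_def e using b by simp
  ultimately show "q = quo p t \<and> r = rem p t" by simp
next
  assume A: "q = quo p t \<and> r = rem p t"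
  have "0 \<le> (int t - 1) mod int p" "(int t - 1) mod int p < int p" using assms by simp_all
  moreover have "(int t - 1) div int p * int p + (int t - 1) mod int p = int t - 1" by simp
  ultimately show "int t = q * int p + int r \<and> r \<in> {1..p}"
    using A by (auto simp: quo_def rem_def)
qed

definition g :: "nat \<Rightarrow> nat \<Rightarrow> nat \<Rightarrow> nat \<Rightarrow> int" where
  "g p d m0 t = quo p t * marith d m0 p + marith d m0 (rem p t)"

definition u_inv :: "nat \<Rightarrow> nat \<Rightarrow> nat \<Rightarrow> nat \<Rightarrow> nat" where
  "u_inv p d m0 n = (LEAST t. g p d m0 t \<notin> Ap (Hsg p d m0 n) (int m0))"

definition v_inv :: "nat \<Rightarrow> nat \<Rightarrow> nat \<Rightarrow> nat \<Rightarrow> nat" where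
  "v_inv p d m0 n = (LEAST b. b \<ge> 1 \<and> int b * int n \<in> Hsg' p d m0)"

definition nu_inv :: "nat \<Rightarrow> nat \<Rightarrow> nat \<Rightarrow> nat \<Rightarrow> nat \<Rightarrow> nat" where
  "nu_inv p u z lam mu = (if rem p (u - z) < rem p u then lam + mu + 1 else lam + mu)"

text \<open>
  The defining property of the integers \<open>z, w, \<lambda>, \<mu>\<close> of Patil and Singh, who prove that exactly
  one such quadruple exists.
\<close>

definition patil_singh ::
    "nat \<Rightarrow> nat \<Rightarrow> nat \<Rightarrow> nat \<Rightarrow> nat \<Rightarrow> nat \<Rightarrow> nat \<Rightarrow> nat \<Rightarrow> bool" where
  "patil_singh p d m0 n z w lam mu \<longleftrightarrow>
     (let u = u_inv p d m0 n; v = v_inv p d m0 n in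
        z < u \<and> w < v \<and> lam \<ge> 1 \<and>
        g p d m0 u = int lam * int m0 + int w * int n \<and>
        int v * int n = int mu * int m0 + g p d m0 z \<and>
        g p d m0 (u - z) + (int v - int w) * int n = int (nu_inv p u z lam mu) * int m0)"

definition Wset :: "nat \<Rightarrow> nat \<Rightarrow> nat \<Rightarrow> nat \<Rightarrow> (nat \<times> nat) set" where
  "Wset u v z w = {u - z..<u} \<times> {v - w..<v}"

definition Iset :: "nat \<Rightarrow> int \<Rightarrow> nat \<Rightarrow> nat set" where
  "Iset p q' r' =
     (if r' = 1 then (if q' = 0 then {p} else {1..p}) else {p + 1..p + r' - 1})"

text \<open>
  For \<open>q' \<ge> 0\<close> and \<open>i \<in> Iset p q' r'\<close> the index \<open>(q' - 1) p + i\<close> is nonnegative, so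
  \<open>nat\<close> does not truncate.
\<close>

definition alpha :: "nat \<Rightarrow> nat \<Rightarrow> nat \<Rightarrow> nat \<Rightarrow> int \<Rightarrow> nat \<Rightarrow> nat \<Rightarrow> int" where
  "alpha p d m0 n q' v i =
     g p d m0 (nat ((q' - 1) * int p + int i)) + (int v - 1) * int n - int m0"

definition PF1 :: "nat \<Rightarrow> nat \<Rightarrow> nat \<Rightarrow> nat \<Rightarrow> int \<Rightarrow> nat \<Rightarrow> nat \<Rightarrow> int set" where
  "PF1 p d m0 n q' r' v =
     {f \<in> PF (Hsg p d m0 n). \<exists>i \<in> Iset p q' r'. f = alpha p d m0 n q' v i}"

text \<open>
  Rows and columns are indexed by \<open>0, \<dots>, p, p + 1\<close>; the last index \<open>p + 1\<close> belongs to the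
  generator \<open>n\<close>.
\<close>

definition RF_matrix :: "nat \<Rightarrow> nat \<Rightarrow> nat \<Rightarrow> nat \<Rightarrow> int \<Rightarrow> int mat \<Rightarrow> bool" where
  "RF_matrix p d m0 n f M \<longleftrightarrow>
     f \<in> PF (Hsg p d m0 n) \<and>
     M \<in> carrier_mat (p + 2) (p + 2) \<and>
     (\<forall>k < p + 2. M $$ (k, k) = -1) \<and>
     (\<forall>k < p + 2. \<forall>j < p + 2. j \<noteq> k \<longrightarrow> M $$ (k, j) \<ge> 0) \<and>
     (\<forall>k < p + 2. (\<Sum>j = 0..p. M $$ (k, j) * marith d m0 j) + M $$ (k, p + 1) * int n = f)"

abbreviation E :: "nat \<Rightarrow> nat \<Rightarrow> int vec" where
  "E p k \<equiv> unit_vec (p + 2) k"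

end

theory Submission
  imports Defs
begin

text \<open>
  Writing \<open>g\<^sub>t = \<lceil>t/p\<rceil> m\<^sub>0 + t d\<close> shows that \<open>g\<close> is additive up to a
  defect \<open>0\<close> or \<open>m\<^sub>0\<close>, and hence \<open>H' = {a m\<^sub>0 + g\<^sub>t}\<close>.  Suppose \<open>\<alpha>\<^sub>i \<in> H\<close>.  Cancelling
  with this near-additivity leaves a relation \<open>g\<^sub>x + c n = k m\<^sub>0\<close> with \<open>0 < x < u - z\<close>
  and \<open>0 < c < v\<close>.  Subtracting it from the relation for \<open>g\<^sub>u\<close> (if \<open>c < v - w\<close>) or from the
  one for \<open>g\<^bsub>u-z\<^esub>\<close> (if \<open>c \<ge> v - w\<close>) yields \<open>g\<^sub>y = k' m\<^sub>0 + c' n\<close> with \<open>0 < y < u\<close> and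
  \<open>0 \<le> c' < v\<close>: for \<open>k' \<ge> 1\<close> this contradicts the minimality of \<open>u\<close>, for \<open>k' \<le> 0\<close> that of
  \<open>v\<close>.  The rows of the matrix give \<open>\<alpha>\<^sub>i + a \<in> H\<close> for all generators \<open>a\<close>, so \<open>\<alpha>\<^sub>i\<close> is
  pseudo-Frobenius.  For \<open>i > p - r + 1\<close>, on the other hand, \<open>\<alpha>\<^sub>i + n = g\<^sub>t - m\<^sub>0\<close> with
  \<open>t < u\<close>, which is not in \<open>H\<close>.
\<close>

section \<open>Subsemigroups generated by finite sets\<close>

lemma semigroup_spanI: "(\<Sum>a\<in>A. int (c a) * a) \<in> semigroup_span A"
  unfolding semigroup_span_def by blast

lemma semigroup_span_zero: "0 \<in> semigroup_span A"
  using semigroup_spanI[of "\<lambda>_. 0" A] by simp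

lemma semigroup_span_base:
  assumes "finite A" "a \<in> A"
  shows "a \<in> semigroup_span A"
proof -
  have "(\<Sum>x\<in>A. int (if x = a then 1 else 0) * x) = (\<Sum>x\<in>A. if x = a then a else 0)"
    by (rule sum.cong) auto
  also have "\<dots> = a" using assms by simp
  finally show ?thesis
    using semigroup_spanI[of "\<lambda>x. if x = a then 1 else 0" A] by (simp only:)
qed

lemma semigroup_span_add:
  assumes "x \<in> semigroup_span A" "y \<in> semigroup_span A"
  shows "x + y \<in> semigroup_span A"
proof -
  obtain c c' where "x = (\<Sum>a\<in>A. int (c a) * a)" "y = (\<Sum>a\<in>A. int (c' a) * a)"
    using assms unfolding semigroup_span_def by blast
  then have "x + y = (\<Sum>a\<in>A. int (c a + c' a) * a)"
    by (simp add: sum.distrib distrib_right)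
  then show ?thesis using semigroup_spanI[of "\<lambda>a. c a + c' a" A] by (simp only:)
qed

lemma semigroup_span_mult:
  assumes "x \<in> semigroup_span A" "k \<ge> 0"
  shows "k * x \<in> semigroup_span A"
proof -
  have "int m * x \<in> semigroup_span A" for m
    by (induction m) (simp_all add: semigroup_span_zero distrib_right semigroup_span_add assms(1))
  from this[of "nat k"] show ?thesis using assms(2) by simp
qed

lemma semigroup_span_sum:
  assumes "\<And>i. i \<in> I \<Longrightarrow> f i \<in> semigroup_span A"
  shows "sum f I \<in> semigroup_span A"
  using assms
  by (induction I rule: infinite_finite_induct)
    (simp_all add: semigroup_span_zero semigroup_span_add)

text \<open>An induction principle: closure under addition passes from generators to multiples and
  then to sums. For infinite \<open>A\<close> the sum is 0 by convention, and
  \<open>0 \<in> S\<close> covers that case.\<close>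

lemma semigroup_span_least:
  assumes "A \<subseteq> S" "0 \<in> S" "\<And>x y. x \<in> S \<Longrightarrow> y \<in> S \<Longrightarrow> x + y \<in> S"
  shows "semigroup_span A \<subseteq> S"
proof -
  have mult: "int m * x \<in> S" if "x \<in> S" for m x
    using that by (induction m) (auto simp: assms(2,3) distrib_right)
  have sum: "sum f I \<in> S" if "\<And>i. i \<in> I \<Longrightarrow> f i \<in> S" for f and I :: "int set"
    using that by (induction I rule: infinite_finite_induct) (auto simp: assms(2,3))
  have "(\<Sum>a\<in>A. int (c a) * a) \<in> S" for c
  proof (rule sum)
    show "int (c a) * a \<in> S" if "a \<in> A" for a
      using mult assms(1) that by blast
  qed
  then show ?thesis by (auto simp: semigroup_span_def)
qed

lemma PF_semigroup_spanI:
  assumes "finite A" "f \<notin> semigroup_span A" "\<And>a. a \<in> A \<Longrightarrow> f + a \<in> semigroup_span A"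
  shows "f \<in> PF (semigroup_span A)"
proof -
  \<comment> \<open>Zero has to be inserted by hand, since \<open>f + 0\<close> lies outside the
    span. The resulting set is still additively closed, so checking \<open>f + a\<close> on
    generators suffices.\<close>
  let ?S = "insert 0 {h \<in> semigroup_span A. f + h \<in> semigroup_span A}"
  have "semigroup_span A \<subseteq> ?S"
  proof (rule semigroup_span_least)
    show "A \<subseteq> ?S" using assms semigroup_span_base by auto
    show "x + y \<in> ?S" if "x \<in> ?S" "y \<in> ?S" for x y
      using that semigroup_span_add[of "f + x" A y] semigroup_span_add[of x A y]
      by (auto simp: add.assoc)
  qed simp
  then have "f + h \<in> semigroup_span A" if "h \<in> semigroup_span A" "h \<noteq> 0" for h
    using that by blast
  then show ?thesis using assms(2) by (simp add: PF_def)
qed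

section \<open>Normal forms in the semigroup\<close>

lemma marith_0 [simp]: "marith d m0 0 = int m0"
  by (simp add: marith_def)

lemma quo_rem: "p \<ge> 1 \<Longrightarrow> int t = quo p t * int p + int (rem p t)"
  and rem_bounds: "p \<ge> 1 \<Longrightarrow> rem p t \<in> {1..p}"
  using quo_rem_unique by blast+

lemma quo_rem_eqI:
  assumes "p \<ge> 1" "int t = q * int p + int r" "r \<in> {1..p}"
  shows "quo p t = q" "rem p t = r"
  using assms quo_rem_unique[OF assms(1), of t q r] by simp_all

text \<open>Here \<open>quo p t + 1\<close> is the ceiling of \<open>t / p\<close>, so the defect of
  additivity of \<open>g\<close> is that of the ceiling function.\<close>

lemma g_altdef:
  assumes "p \<ge> 1"
  shows "g p d m0 t = (quo p t + 1) * int m0 + int t * int d"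
  using quo_rem[OF assms, of t] unfolding g_def marith_def
  by (simp add: algebra_simps)

lemma g_eqI:
  assumes "p \<ge> 1" "int t = q * int p + int r" "r \<in> {1..p}"
  shows "g p d m0 t = q * marith d m0 p + marith d m0 r"
  unfolding g_def using quo_rem_eqI[OF assms] by simp

lemma g_0: "p \<ge> 1 \<Longrightarrow> g p d m0 0 = 0"
  using g_eqI[of p 0 "-1" p d m0] by simp

lemma quo_nonneg:
  assumes "t \<ge> 1"
  shows "quo p t \<ge> 0"
  unfolding quo_def using assms by (simp add: div_int_pos_iff)

lemma g_pos:
  assumes "p \<ge> 1" "m0 \<ge> 1" "t \<ge> 1"
  shows "g p d m0 t > 0"
proof -
  have "(quo p t + 1) * int m0 > 0"
    using quo_nonneg[OF assms(3), of p] assms(2) by (intro mult_pos_pos) auto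
  then show ?thesis
    unfolding g_altdef[OF assms(1)] by (intro add_pos_nonneg) auto
qed

text \<open>The defect depends only on the remainders in \<open>[1,p]\<close>: without a carry the
  shift by one in \<open>quo p t + 1\<close> is counted twice, giving \<open>e = 1\<close>; a carry
  compensates for this, giving \<open>e = 0\<close>.\<close>

lemma g_add:
  assumes "p \<ge> 1"
  obtains e where "e \<in> {0, 1}" "g p d m0 x + g p d m0 y = g p d m0 (x + y) + e * int m0"
proof -
  have x: "int x = quo p x * int p + int (rem p x)" "rem p x \<in> {1..p}"
    and y: "int y = quo p y * int p + int (rem p y)" "rem p y \<in> {1..p}"
    using quo_rem[OF assms] rem_bounds[OF assms] by blast+
  consider "rem p x + rem p y \<le> p" | "rem p x + rem p y > p" by linarith
  then show ?thesis
  proof cases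
    case 1
    have "int (x + y) = (quo p x + quo p y) * int p + int (rem p x + rem p y)"
      using x(1) y(1) by (simp add: algebra_simps)
    then have "quo p (x + y) = quo p x + quo p y"
      by (rule quo_rem_eqI(1)[OF assms]) (use 1 x(2) in auto)
    then show ?thesis using that[of 1] assms by (simp add: g_altdef algebra_simps)
  next
    case 2
    have "int (x + y) = (quo p x + quo p y + 1) * int p + int (rem p x + rem p y - p)"
      using x(1) y(1) 2 by (simp add: algebra_simps of_nat_diff)
    then have "quo p (x + y) = quo p x + quo p y + 1"
      by (rule quo_rem_eqI(1)[OF assms]) (use 2 x(2) y(2) in auto)
    then show ?thesis using that[of 0] assms by (simp add: g_altdef algebra_simps)
  qed
qed

lemma finite_gens: "finite (gens p d m0 n)"
  by (simp add: gens_def)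

lemma g_in_semigroup_span:
  assumes "p \<ge> 1" "finite A" "marith d m0 ` {0..p} \<subseteq> A"
  shows "g p d m0 t \<in> semigroup_span A"
proof (cases "t = 0")
  case True
  then show ?thesis using g_0[OF assms(1)] semigroup_span_zero by simp
next
  case False
  have m: "marith d m0 i \<in> semigroup_span A" if "i \<le> p" for i
    using assms that by (intro semigroup_span_base) auto
  have "quo p t \<ge> 0" using quo_nonneg False by simp
  then have "quo p t * marith d m0 p \<in> semigroup_span A"
    by (rule semigroup_span_mult[OF m[OF order.refl]])
  moreover have "marith d m0 (rem p t) \<in> semigroup_span A"
    using rem_bounds[OF assms(1), of t] by (intro m) simp
  ultimately show ?thesis unfolding g_def by (rule semigroup_span_add)
qed

lemma marith_normal_form:
  assumes "p \<ge> 1" "i \<le> p"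
  obtains a t where "a \<ge> 0" "marith d m0 i = a * int m0 + g p d m0 t"
proof (cases "i = 0")
  case True
  \<comment> \<open>Since \<open>g\<close> at 0 is 0 rather than \<open>m0\<close>, the generator
    \<open>m0\<close> needs the coefficient 1 in front.\<close>
  then show ?thesis by (intro that[of 1 0]) (simp_all add: g_0[OF assms(1)])
next
  case False
  then have "g p d m0 i = marith d m0 i"
    using g_eqI[OF assms(1), of i 0 i d m0] assms(2) by simp
  then show ?thesis by (intro that[of 0 i]) simp_all
qed

lemma Hsg'_I:
  assumes "p \<ge> 1" "a \<ge> 0"
  shows "a * int m0 + g p d m0 t \<in> Hsg' p d m0"
proof -
  have "int m0 \<in> marith d m0 ` {0..p}" by (rule image_eqI[of _ _ 0]) auto
  then have "int m0 \<in> semigroup_span (marith d m0 ` {0..p})"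
    by (intro semigroup_span_base) auto
  then have "a * int m0 \<in> semigroup_span (marith d m0 ` {0..p})"
    using assms(2) by (rule semigroup_span_mult)
  moreover have "g p d m0 t \<in> semigroup_span (marith d m0 ` {0..p})"
    using assms(1) by (intro g_in_semigroup_span) auto
  ultimately show ?thesis unfolding Hsg'_def by (rule semigroup_span_add)
qed

lemma HsgI:
  assumes "p \<ge> 1" "a \<ge> 0" "b \<ge> 0"
  shows "a * int m0 + g p d m0 t + b * int n \<in> Hsg p d m0 n"
proof -
  have "int m0 \<in> gens p d m0 n" unfolding gens_def by (intro insertI2 image_eqI[of _ _ 0]) auto
  moreover have "int n \<in> gens p d m0 n" by (simp add: gens_def)
  moreover have "g p d m0 t \<in> semigroup_span (gens p d m0 n)"
    using assms(1) by (intro g_in_semigroup_span) (auto simp: gens_def)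
  ultimately show ?thesis unfolding Hsg_def using assms(2,3)
    by (blast intro: semigroup_span_add semigroup_span_mult semigroup_span_base finite_gens)
qed

text \<open>The normal forms contain the generators and are closed under addition, because the
  defect of \<open>g_add\<close> is nonnegative and can be absorbed into the coefficient of
  \<open>m0\<close>.\<close>

lemma HsgE:
  assumes "p \<ge> 1" "h \<in> Hsg p d m0 n"
  obtains a t b where "a \<ge> 0" "b \<ge> 0" "h = a * int m0 + g p d m0 t + b * int n"
proof -
  define S where
    "S = {h. \<exists>a t b. a \<ge> 0 \<and> b \<ge> 0 \<and> h = a * int m0 + g p d m0 t + b * int n}"
  have memI: "h \<in> S" if "a \<ge> 0" "b \<ge> 0" "h = a * int m0 + g p d m0 t + b * int n" for h a t b
    unfolding S_def using that by blast
  have memD: "\<exists>a t b. a \<ge> 0 \<and> b \<ge> 0 \<and> h = a * int m0 + g p d m0 t + b * int n" if "h \<in> S" for h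
    using that unfolding S_def by blast
  have "semigroup_span (gens p d m0 n) \<subseteq> S"
  proof (rule semigroup_span_least)
    show "0 \<in> S" by (rule memI[of 0 0 _ 0]) (simp_all add: g_0[OF assms(1)])
    have "int n \<in> S" by (rule memI[of 0 1 _ 0]) (simp_all add: g_0[OF assms(1)])
    moreover have "marith d m0 i \<in> S" if i: "i \<le> p" for i
    proof -
      obtain a t where "a \<ge> 0" "marith d m0 i = a * int m0 + g p d m0 t"
        by (rule marith_normal_form[OF assms(1) i])
      then show ?thesis by (intro memI[of a 0 _ t]) simp_all
    qed
    ultimately show "gens p d m0 n \<subseteq> S" unfolding gens_def by auto
    show "x + y \<in> S" if xy: "x \<in> S" "y \<in> S" for x y
    proof -
      obtain a t b where x: "a \<ge> 0" "b \<ge> 0" "x = a * int m0 + g p d m0 t + b * int n"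
        using memD[OF xy(1)] by blast
      obtain a' t' b' where y: "a' \<ge> 0" "b' \<ge> 0" "y = a' * int m0 + g p d m0 t' + b' * int n"
        using memD[OF xy(2)] by blast
      obtain e where e: "e \<in> {0, 1}" "g p d m0 t + g p d m0 t' = g p d m0 (t + t') + e * int m0"
        by (rule g_add[OF assms(1)])
      have "x + y = (a + a' + e) * int m0 + g p d m0 (t + t') + (b + b') * int n"
        using x(3) y(3) e(2) by (simp add: algebra_simps)
      then show ?thesis using x(1,2) y(1,2) e(1) by (intro memI[of "a + a' + e" "b + b'"]) auto
    qed
  qed
  then have "h \<in> S" using assms(2) unfolding Hsg_def by (rule subsetD)
  then show ?thesis using memD that by blast
qed

section \<open>Minimality of u and v\<close>

lemma u_inv_minimal:
  assumes "p \<ge> 1" "t < u_inv p d m0 n"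
  shows "g p d m0 t - int m0 \<notin> Hsg p d m0 n"
proof -
  have "g p d m0 t \<in> Ap (Hsg p d m0 n) (int m0)"
    using not_less_Least[of t "\<lambda>t. g p d m0 t \<notin> Ap (Hsg p d m0 n) (int m0)"] assms(2)
    unfolding u_inv_def by blast
  then show ?thesis unfolding Ap_def by blast
qed

lemma v_inv_minimal:
  assumes "1 \<le> b" "b < int (v_inv p d m0 n)"
  shows "b * int n \<notin> Hsg' p d m0"
proof -
  have "nat b < v_inv p d m0 n" using assms by linarith
  then show ?thesis
    using not_less_Least[of "nat b" "\<lambda>b. b \<ge> 1 \<and> int b * int n \<in> Hsg' p d m0"] assms(1)
    unfolding v_inv_def by auto
qed

text \<open>The sign of \<open>k\<close> decides which minimality is violated: a positive
  \<open>k\<close> puts \<open>g - m0\<close> into \<open>H\<close>, while otherwise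
  \<open>c * n\<close> is a positive element of \<open>H'\<close> with \<open>c < v\<close>.\<close>

lemma g_neq_below_u:
  assumes "p \<ge> 1" "m0 \<ge> 1" "1 \<le> y" "y < u_inv p d m0 n" "0 \<le> c" "c < int (v_inv p d m0 n)"
  shows "g p d m0 y \<noteq> k * int m0 + c * int n"
proof
  assume eq: "g p d m0 y = k * int m0 + c * int n"
  show False
  proof (cases "k \<ge> 1")
    case True
    have "(k - 1) * int m0 + g p d m0 0 + c * int n \<in> Hsg p d m0 n"
      using assms True by (intro HsgI) auto
    then have "g p d m0 y - int m0 \<in> Hsg p d m0 n"
      using eq g_0[OF assms(1)] by (simp add: algebra_simps)
    then show False using u_inv_minimal assms by blast
  next
    case False
    then have k: "- k \<ge> 0" by simp
    have cn: "c * int n = (- k) * int m0 + g p d m0 y" using eq by simp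
    moreover have "(- k) * int m0 \<ge> 0" using k by (intro mult_nonneg_nonneg) auto
    ultimately have "c * int n > 0" using g_pos[OF assms(1,2,3), of d] by linarith
    then have "c \<ge> 1" using assms(5) by (cases "c = 0") auto
    moreover have "c * int n \<in> Hsg' p d m0" unfolding cn by (rule Hsg'_I[OF assms(1) k])
    ultimately show False using v_inv_minimal assms(6) by blast
  qed
qed

text \<open>Subtraction from the relation for \<open>g\<close> at \<open>u\<close> raises the
  coefficient of \<open>n\<close> to \<open>w + c\<close>, which stays below \<open>v\<close> only
  when \<open>c < v - w\<close>. Otherwise the relation at \<open>u - z\<close> is used, which
  leaves \<open>c - (v - w) \<ge> 0\<close>.\<close>

lemma g_plus_neq_multiple:
  assumes p: "p \<ge> 1" and m0: "m0 \<ge> 1"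
    and u: "u = u_inv p d m0 n" and v: "v = v_inv p d m0 n" and wv: "w < v"
    and gu: "g p d m0 u = lam * int m0 + int w * int n"
    and guz: "g p d m0 (u - z) + (int v - int w) * int n = nu * int m0"
    and x: "1 \<le> x" "x < u - z" and c: "1 \<le> c" "c < int v"
  shows "g p d m0 x + c * int n \<noteq> k * int m0"
proof
  assume eq: "g p d m0 x + c * int n = k * int m0"
  consider "c < int v - int w" | "c \<ge> int v - int w" by linarith
  then show False
  proof cases
    case 1
    obtain e where "g p d m0 x + g p d m0 (u - x) = g p d m0 (x + (u - x)) + e * int m0"
      by (rule g_add[OF p])
    moreover have "x + (u - x) = u" using x by simp
    ultimately have "g p d m0 (u - x) = (lam + e - k) * int m0 + (int w + c) * int n"
      using eq gu by (simp add: algebra_simps)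
    moreover have "1 \<le> u - x" "u - x < u" using x by linarith+
    ultimately show False
      using g_neq_below_u[of p m0 "u - x" d n "int w + c" "lam + e - k"] p m0 c 1 u v by simp
  next
    case 2
    let ?y = "u - z - x"
    obtain e where "g p d m0 x + g p d m0 ?y = g p d m0 (x + ?y) + e * int m0"
      by (rule g_add[OF p])
    moreover have "x + ?y = u - z" using x by simp
    ultimately have "g p d m0 ?y = (nu + e - k) * int m0 + (c - (int v - int w)) * int n"
      using eq guz by (simp add: algebra_simps)
    moreover have "1 \<le> ?y" "?y < u" "c - (int v - int w) < int v" using x c wv by linarith+
    ultimately show False
      using g_neq_below_u[of p m0 ?y d n "c - (int v - int w)" "nu + e - k"] p m0 2 u v by simp
  qed
qed

lemma g_plus_not_in_Hsg:
  assumes p: "p \<ge> 1" and m0: "m0 \<ge> 1"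
    and u: "u = u_inv p d m0 n" and v: "v = v_inv p d m0 n" and wv: "w < v"
    and gu: "g p d m0 u = lam * int m0 + int w * int n"
    and guz: "g p d m0 (u - z) + (int v - int w) * int n = nu * int m0"
    and s: "s < u - z"
  shows "g p d m0 s + (int v - 1) * int n - int m0 \<notin> Hsg p d m0 n"
proof
  assume "g p d m0 s + (int v - 1) * int n - int m0 \<in> Hsg p d m0 n"
  then obtain a t b where ab: "a \<ge> 0" "b \<ge> 0"
    and eq: "g p d m0 s + (int v - 1) * int n - int m0 = a * int m0 + g p d m0 t + b * int n"
    by (rule HsgE[OF p])
  define c where "c = int v - 1 - b"
  have eq': "g p d m0 s + c * int n = (a + 1) * int m0 + g p d m0 t"
    using eq unfolding c_def by (simp add: algebra_simps)
  have cv: "c < int v" using ab unfolding c_def by simp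
  show False
  proof (cases "c \<ge> 1")
    \<comment> \<open>All \<open>n\<close>-terms can be moved to the right-hand side, so
      \<open>g p d m0 s - int m0\<close> itself would lie in \<open>H\<close> although
      \<open>s < u\<close>.\<close>
    case False
    have "a * int m0 + g p d m0 t + (- c) * int n \<in> Hsg p d m0 n"
      using p ab False by (intro HsgI) auto
    moreover have "a * int m0 + g p d m0 t + (- c) * int n = g p d m0 s - int m0"
      using eq' by (simp add: algebra_simps)
    ultimately have "g p d m0 s - int m0 \<in> Hsg p d m0 n" by (simp only:)
    then show False using u_inv_minimal[OF p, of s d m0 n] s u by simp
  next
    case c: True
    show False
    proof (cases "t \<ge> s")
      case True
      obtain e where e: "e \<in> {0, 1}"
        "g p d m0 s + g p d m0 (t - s) = g p d m0 (s + (t - s)) + e * int m0"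
        by (rule g_add[OF p])
      have "c * int n = (a + 1 - e) * int m0 + g p d m0 (t - s)"
        using e(2) eq' True by (simp add: algebra_simps)
      \<comment> \<open>The \<open>m0\<close> subtracted on the left of the original equation pays
        for the possible defect \<open>e = 1\<close>.\<close>
      moreover have "a + 1 - e \<ge> 0" using e(1) ab by auto
      ultimately have "c * int n \<in> Hsg' p d m0" using Hsg'_I[OF p] by metis
      then show False using v_inv_minimal c cv v by blast
    next
      case False
      obtain e where e: "g p d m0 t + g p d m0 (s - t) = g p d m0 (t + (s - t)) + e * int m0"
        by (rule g_add[OF p])
      have "g p d m0 (s - t) + c * int n = (a + 1 + e) * int m0"
        using e eq' False by (simp add: algebra_simps)
      moreover have "1 \<le> s - t" "s - t < u - z" using False s by auto
      ultimately show False
        using g_plus_neq_multiple[OF p m0 u v wv gu guz _ _ c cv] by blast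
    qed
  qed
qed

section \<open>Matrices of row-factorizations\<close>

text \<open>Turns the weight of a row into a scalar product, so that rows written as combinations of
  unit vectors are evaluated by linearity.\<close>

definition gens_vec :: "nat \<Rightarrow> nat \<Rightarrow> nat \<Rightarrow> nat \<Rightarrow> int vec" where
  "gens_vec p d m0 n = vec (p + 2) (\<lambda>j. if j \<le> p then marith d m0 j else int n)"

lemma gens_vec_carrier [simp]: "gens_vec p d m0 n \<in> carrier_vec (p + 2)"
  by (simp add: gens_vec_def)

lemma gens_vec_index:
  "j \<le> p \<Longrightarrow> gens_vec p d m0 n $ j = marith d m0 j"
  "gens_vec p d m0 n $ (p + 1) = int n"
  by (simp_all add: gens_vec_def)

lemma scalar_prod_gens_vec:
  "b \<bullet> gens_vec p d m0 n = (\<Sum>j = 0..p. b $ j * marith d m0 j) + b $ (p + 1) * int n"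
proof -
  have "{0..<p + 2} = insert (p + 1) {0..p}" by auto
  then show ?thesis by (simp add: scalar_prod_def gens_vec_def)
qed

text \<open>Membership in \<open>PF\<close> comes from the rows: moving the diagonal
  \<open>-1\<close> of row \<open>k\<close> to the other side writes \<open>f\<close> plus the
  \<open>k\<close>-th generator as a nonnegative combination of the generators.\<close>

lemma RF_matrixI:
  assumes f: "f \<notin> Hsg p d m0 n" and M: "M \<in> carrier_mat (p + 2) (p + 2)"
    and diag: "\<And>k. k < p + 2 \<Longrightarrow> row M k $ k = -1"
    and off: "\<And>k j. k < p + 2 \<Longrightarrow> j < p + 2 \<Longrightarrow> j \<noteq> k \<Longrightarrow> row M k $ j \<ge> 0"
    and rows: "\<And>k. k < p + 2 \<Longrightarrow> row M k \<bullet> gens_vec p d m0 n = f"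
  shows "RF_matrix p d m0 n f M"
proof -
  let ?G = "gens_vec p d m0 n"
  have entry: "row M k $ j = M $$ (k, j)" if "k < p + 2" "j < p + 2" for k j
    using M that by simp
  have G: "?G $ j \<in> gens p d m0 n" if "j < p + 2" for j
    using that unfolding gens_vec_def gens_def by auto
  have step: "f + ?G $ k \<in> Hsg p d m0 n" if k: "k < p + 2" for k
  proof -
    have "f = (\<Sum>j\<in>{0..<p + 2}. row M k $ j * ?G $ j)"
      using rows[OF k] by (simp add: scalar_prod_def gens_vec_def)
    also have "\<dots> = - ?G $ k + (\<Sum>j\<in>{0..<p + 2} - {k}. row M k $ j * ?G $ j)"
      using k diag[OF k] by (subst sum.remove[of _ k]) auto
    finally have "f + ?G $ k = (\<Sum>j\<in>{0..<p + 2} - {k}. row M k $ j * ?G $ j)" by simp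
    also have "\<dots> \<in> Hsg p d m0 n" unfolding Hsg_def
      using off[OF k] G
      by (intro semigroup_span_sum semigroup_span_mult semigroup_span_base finite_gens) auto
    finally show ?thesis .
  qed
  have "\<exists>k < p + 2. ?G $ k = a" if a: "a \<in> gens p d m0 n" for a
  proof (cases "a = int n")
    case True
    then show ?thesis using gens_vec_index(2) by (intro exI[of _ "p + 1"]) auto
  next
    case False
    then obtain i where "i \<le> p" "a = marith d m0 i" using a unfolding gens_def by auto
    then show ?thesis using gens_vec_index(1) by (intro exI[of _ i]) auto
  qed
  then have "f + a \<in> Hsg p d m0 n" if "a \<in> gens p d m0 n" for a
    using step that by metis
  then have "f \<in> PF (Hsg p d m0 n)"
    using PF_semigroup_spanI[OF finite_gens] f unfolding Hsg_def by blast
  moreover have "(\<Sum>j = 0..p. M $$ (k, j) * marith d m0 j) + M $$ (k, p + 1) * int n = f"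
    if k: "k < p + 2" for k
    using rows[OF k] entry[OF k] unfolding scalar_prod_gens_vec by simp
  ultimately show ?thesis
    unfolding RF_matrix_def using M diag off entry by auto
qed

theorem proposition4p5:
  fixes p d m0 n u v z w lam mu nu r r' :: nat and q q' :: int
  assumes "p \<ge> 1" and "d \<ge> 1" and "m0 \<ge> 1" and "n \<ge> 1"
    and "Gcd {m0, d, n} = 1"
    and "minimal_generating_set (gens p d m0 n) (Hsg p d m0 n)"
    and "u = u_inv p d m0 n" and "v = v_inv p d m0 n"
    and "patil_singh p d m0 n z w lam mu"
    and "nu = nu_inv p u z lam mu"
    and "r = rem p u" and "q = quo p u"
    and "r' = rem p (u - z)" and "q' = quo p (u - z)"
    and "Wset u v z w \<noteq> {}"
    and "r' = 1" and "mu = 0" and "q' > 0" and "r \<ge> 2"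
  shows "PF1 p d m0 n q' r' v = alpha p d m0 n q' v ` {1..p - r + 1} \<and>
    (\<forall>i \<in> {1..p - r + 1}. \<exists>M. RF_matrix p d m0 n (alpha p d m0 n q' v i) M \<and>
       row M 0 = - E p 0 + (q' - 1) \<cdot>\<^sub>v E p p + (int v - 1) \<cdot>\<^sub>v E p (p + 1) + E p i \<and>
       (\<forall>j \<in> {1..p - i}.
          row M j = - E p j + (q' - 1) \<cdot>\<^sub>v E p p + (int v - 1) \<cdot>\<^sub>v E p (p + 1) + E p (i + j)) \<and>
       (\<forall>j \<in> {p - i + 1..p}.
          row M j = (int nu - 2) \<cdot>\<^sub>v E p 0 - E p j + (int w - 1) \<cdot>\<^sub>v E p (p + 1)
                    + E p (i + j - p - 1)) \<and>
       row M (p + 1) = (q - 1) \<cdot>\<^sub>v E p p - E p (p + 1) + E p (r + i - 1))"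
proof -
  note p = assms(1) and m0 = assms(3)
  let ?H = "Hsg p d m0 n" and ?m = "marith d m0" and ?\<alpha> = "alpha p d m0 n q' v"
  have zu: "z < u" and wv: "w < v" and lam: "lam \<ge> 1"
    and gu: "g p d m0 u = int lam * int m0 + int w * int n"
    and vn: "int v * int n = g p d m0 z"
    and guz: "g p d m0 (u - z) + (int v - int w) * int n = int nu * int m0"
    using assms(7-10,17) unfolding patil_singh_def Let_def by auto
  have w: "w \<ge> 1" using assms(15) unfolding Wset_def by auto
  have r: "r \<in> {1..p}" and u: "int u = q * int p + int r"
    using quo_rem[OF p, of u] rem_bounds[OF p, of u] assms(11,12) by simp_all
  have uz: "int u - int z = q' * int p + 1"
    using quo_rem[OF p, of "u - z"] assms(13,14,16) zu by simp
  \<comment> \<open>As \<open>r \<ge> 2\<close>, the number \<open>r - 1\<close> lies in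
    \<open>[1,p]\<close>, so this is the decomposition of \<open>z\<close> that defines
    \<open>g\<close> at \<open>z\<close>.\<close>
  have z: "int z = (q - q') * int p + int (r - 1)"
    using u uz assms(19) by (simp add: algebra_simps of_nat_diff)
  have "q \<ge> q'"
  proof (rule ccontr)
    assume "\<not> q \<ge> q'"
    then have "(q - q') * int p \<le> (- 1) * int p" by (intro mult_right_mono) auto
    then show False using z r by auto
  qed
  then have q: "q \<ge> 1" using assms(18) by simp
  \<comment> \<open>From \<open>r' = 1 < r\<close> the first case of \<open>nu_inv\<close> applies,
    so \<open>nu = lam + 1\<close>; this makes the coefficient \<open>nu - 2\<close> of a row
    admissible.\<close>
  have nu: "nu \<ge> 2"
    using assms(10,11,13,16,17,19) lam unfolding nu_inv_def by simp
  have vn': "int v * int n = (q - q') * ?m p + ?m (r - 1)"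
    unfolding vn using z r assms(19) by (intro g_eqI[OF p]) auto
  have nu': "int nu * int m0 = q' * ?m p + ?m 1 + (int v - int w) * int n"
    using guz g_eqI[OF p, of "u - z" q' 1 d m0] uz zu p by (simp add: of_nat_diff)
  have idx: "int (nat ((q' - 1) * int p + int i)) = (q' - 1) * int p + int i" for i
    using assms(18) by simp
  have alpha: "?\<alpha> i = (q' - 1) * ?m p + ?m i + (int v - 1) * int n - int m0"
    if "i \<in> {1..p}" for i
    unfolding alpha_def using g_eqI[OF p idx that] by simp

  have not_PF: "?\<alpha> i \<notin> PF ?H" if i: "i \<in> {1..p}" "i > p - r + 1" for i
  proof
    assume "?\<alpha> i \<in> PF ?H"
    moreover have "int n \<in> ?H" unfolding Hsg_def
      by (intro semigroup_span_base finite_gens) (simp add: gens_def)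
    ultimately have mem: "?\<alpha> i + int n \<in> ?H" using assms(4) unfolding PF_def by auto
    \<comment> \<open>This is \<open>u - (p - i) - 1\<close>, hence below \<open>u\<close>. Since
      \<open>i + (r - 1) > p\<close>, adding the relation for \<open>v * n\<close> to
      \<open>?\<alpha> i + n\<close> carries one \<open>m_p\<close>, which raises
      \<open>q - 1\<close> to \<open>q\<close>.\<close>
    define t where "t = nat (q * int p + int (i + r - 1 - p))"
    have t: "int t = q * int p + int (i + r - 1 - p)" unfolding t_def using q by simp
    have r'': "i + r - 1 - p \<in> {1..p}" using i r by auto
    have "t < u" using t u i r by auto
    then have "g p d m0 t - int m0 \<notin> ?H" using u_inv_minimal[OF p] assms(7) by simp
    moreover have "?m i + ?m (r - 1) = ?m p + ?m (i + r - 1 - p)"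
      using i r assms(19) unfolding marith_def by (simp add: of_nat_diff algebra_simps)
    then have "?\<alpha> i + int n = g p d m0 t - int m0"
      unfolding alpha[OF i(1)] g_eqI[OF p t r''] using vn' by (simp add: algebra_simps)
    ultimately show False using mem by simp
  qed

  have RF: "\<exists>M. RF_matrix p d m0 n (?\<alpha> i) M \<and>
       row M 0 = - E p 0 + (q' - 1) \<cdot>\<^sub>v E p p + (int v - 1) \<cdot>\<^sub>v E p (p + 1) + E p i \<and>
       (\<forall>j \<in> {1..p - i}.
          row M j = - E p j + (q' - 1) \<cdot>\<^sub>v E p p + (int v - 1) \<cdot>\<^sub>v E p (p + 1) + E p (i + j)) \<and>
       (\<forall>j \<in> {p - i + 1..p}.
          row M j = (int nu - 2) \<cdot>\<^sub>v E p 0 - E p j + (int w - 1) \<cdot>\<^sub>v E p (p + 1)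
                    + E p (i + j - p - 1)) \<and>
       row M (p + 1) = (q - 1) \<cdot>\<^sub>v E p p - E p (p + 1) + E p (r + i - 1)"
    if i: "i \<in> {1..p - r + 1}" for i
  proof -
    have ip: "i \<in> {1..p}" using i r assms(19) by auto
    \<comment> \<open>Row 0 is the case \<open>k = 0\<close> of the first branch. The branches
      separate \<open>i + k \<le> p\<close>, where \<open>E p (i + k)\<close> is a valid column of
      the arithmetic part, from \<open>i + k > p\<close>.\<close>
    define R where "R k =
      (if k \<le> p - i
       then - E p k + (q' - 1) \<cdot>\<^sub>v E p p + (int v - 1) \<cdot>\<^sub>v E p (p + 1) + E p (i + k)
       else if k \<le> p
       then (int nu - 2) \<cdot>\<^sub>v E p 0 - E p k + (int w - 1) \<cdot>\<^sub>v E p (p + 1) + E p (i + k - p - 1)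
       else (q - 1) \<cdot>\<^sub>v E p p - E p (p + 1) + E p (r + i - 1))" for k
    define M where "M = mat\<^sub>r (p + 2) (p + 2) R"
    have R: "R k \<in> carrier_vec (p + 2)" for k
      unfolding R_def by auto
    have row: "row M k = R k" if "k < p + 2" for k
      unfolding M_def using R that by simp
    \<comment> \<open>Because \<open>r' = 1\<close>, the number \<open>u - z\<close> is
      \<open>q' * p + 1\<close>, so the index in \<open>?\<alpha> i\<close> lies strictly below
      it.\<close>
    have "(q' - 1) * int p + int i \<le> q' * int p" using ip by (simp add: algebra_simps)
    then have "nat ((q' - 1) * int p + int i) < u - z" using uz zu by linarith
    from g_plus_not_in_Hsg[OF p m0 assms(7,8) wv gu guz this]
    have notin: "?\<alpha> i \<notin> ?H" unfolding alpha_def .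
    let ?G = "gens_vec p d m0 n"
    have E: "E p k \<bullet> ?G = ?m k" if "k \<le> p" for k
      using that scalar_prod_left_unit[OF gens_vec_carrier, of k] by (simp add: gens_vec_index(1))
    have Em: "- E p k \<bullet> ?G = - ?m k" if "k \<le> p" for k
      by (subst scalar_prod_uminus_left) (simp_all only: E[OF that], simp add: gens_vec_def)
    have En: "E p (p + 1) \<bullet> ?G = int n"
      using scalar_prod_left_unit[OF gens_vec_carrier, of "p + 1"] gens_vec_index(2) by simp
    note prod = add_scalar_prod_distrib[where n = "p + 2"]
      minus_scalar_prod_distrib[where n = "p + 2"]
      smult_scalar_prod_distrib[where n = "p + 2"]
    have wt: "R k \<bullet> ?G = ?\<alpha> i" if k: "k < p + 2" for k
    proof -
      consider "k \<le> p - i" | "p - i < k" "k \<le> p" | "k = p + 1" using k by linarith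
      then show ?thesis
      proof cases
        case 1
        then have le: "k \<le> p" "i + k \<le> p" using ip by auto
        have "R k \<bullet> ?G = - ?m k + (q' - 1) * ?m p + (int v - 1) * int n + ?m (i + k)"
          unfolding R_def using 1 Em[OF le(1)] E[of p] E[OF le(2)] En
          by (simp add: prod del: scalar_prod_left_unit add_2_eq_Suc')
        then show ?thesis unfolding alpha[OF ip] by (simp add: marith_def algebra_simps)
      next
        \<comment> \<open>The overflow \<open>i + k > p\<close> is rewritten as
          \<open>m_i + m_k = m_p + m_1 + m_{i+k-p-1} - m0\<close>; then
          \<open>q' * m_p + m_1\<close> is traded for \<open>nu * m0 - (v - w) * n\<close>. The
          truncated subtraction is exact since \<open>k > p - i\<close>.\<close>
        case 2
        then have le: "i + k - p - 1 \<le> p" and eq: "int (i + k - p - 1) = int i + int k - int p - 1"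
          using ip by auto
        have "R k \<bullet> ?G = (int nu - 2) * int m0 - ?m k + (int w - 1) * int n + ?m (i + k - p - 1)"
          unfolding R_def using 2 E[of 0] E[OF 2(2)] E[of p] E[OF le] En
          by (simp add: prod del: scalar_prod_left_unit add_2_eq_Suc')
        moreover have "?m (i + k - p - 1) + ?m 1 = ?m k + ?m i + int m0 - ?m p"
          unfolding marith_def eq by (simp add: algebra_simps)
        ultimately show ?thesis unfolding alpha[OF ip] using nu' by (simp add: algebra_simps)
      next
        case 3
        then have "\<not> k \<le> p - i" "\<not> k \<le> p" by simp_all
        \<comment> \<open>The bound \<open>i \<le> p - r + 1\<close> is used here:
          \<open>m_i + m_{r-1} = m0 + m_{r+i-1}\<close> involves no overflow, after
          \<open>v * n\<close> has been replaced by its expression in \<open>H'\<close>.\<close>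
        moreover have le: "r + i - 1 \<le> p" and eq: "int (r + i - 1) = int i + int (r - 1)"
          using i r assms(19) by auto
        ultimately have "R k \<bullet> ?G = (q - 1) * ?m p - int n + ?m (r + i - 1)"
          unfolding R_def using E[of p] E[OF le] En
          by (simp add: prod del: scalar_prod_left_unit add_2_eq_Suc')
        moreover have "?m (r + i - 1) + int m0 = ?m i + ?m (r - 1)"
          unfolding marith_def eq by (simp add: algebra_simps)
        ultimately show ?thesis unfolding alpha[OF ip] using vn' by (simp add: algebra_simps)
      qed
    qed
    have "RF_matrix p d m0 n (?\<alpha> i) M"
    proof (rule RF_matrixI[OF notin])
      show "M \<in> carrier_mat (p + 2) (p + 2)" by (simp add: M_def)
      show "row M k \<bullet> ?G = ?\<alpha> i" if "k < p + 2" for k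
        using wt row that by simp
      \<comment> \<open>No other unit vector of row \<open>k\<close> hits column \<open>k\<close>:
        in the first branch \<open>k < p\<close> and \<open>i \<ge> 1\<close>, in the second
        \<open>k \<ge> 1\<close> and \<open>i + k - p - 1 < k\<close>, and the last row has its
        other entries in columns up to \<open>p\<close>.\<close>
      show "row M k $ k = - 1" if k: "k < p + 2" for k
        unfolding row[OF k] R_def using k i ip r assms(19) by auto
      show "row M k $ j \<ge> 0" if k: "k < p + 2" and j: "j < p + 2" "j \<noteq> k" for k j
        unfolding row[OF k] R_def using k j i ip r q nu w wv assms(18,19) by auto
    qed
    moreover have "row M 0 = - E p 0 + (q' - 1) \<cdot>\<^sub>v E p p + (int v - 1) \<cdot>\<^sub>v E p (p + 1) + E p i"
      by (simp add: row R_def)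
    moreover have "\<not> p + 1 \<le> p - i" by simp
    then have "row M (p + 1) = (q - 1) \<cdot>\<^sub>v E p p - E p (p + 1) + E p (r + i - 1)"
      by (simp add: row R_def)
    ultimately show ?thesis by (intro exI[of _ M]) (auto simp: row R_def)
  qed

  have "PF1 p d m0 n q' r' v = ?\<alpha> ` {1..p - r + 1}"
  proof
    \<comment> \<open>With \<open>r' = 1\<close> and \<open>q' > 0\<close> the index set is
      \<open>{1..p}\<close>, and \<open>not_PF\<close> removes its upper part.\<close>
    show "PF1 p d m0 n q' r' v \<subseteq> ?\<alpha> ` {1..p - r + 1}"
      unfolding PF1_def Iset_def using not_PF assms(16,18) by fastforce
    have "?\<alpha> i \<in> PF ?H" if "i \<in> {1..p - r + 1}" for i
      using RF[OF that] unfolding RF_matrix_def by blast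
    moreover have "i \<in> Iset p q' r'" if "i \<in> {1..p - r + 1}" for i
      using that r assms(16,18,19) unfolding Iset_def by auto
    ultimately show "?\<alpha> ` {1..p - r + 1} \<subseteq> PF1 p d m0 n q' r' v"
      unfolding PF1_def by blast
  qed
  then show ?thesis using RF by blast
qed

end
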